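(* Asymptotically almost surely, the branchwidth of a graph drawn randomly from $G(n,\frac12)$ is $\Theta(n)$. That is, there exist constants $0<c\le C$ such that, for $G$ drawn from $G(n,\frac12)$, $$\lim_{n\to\infty}\Pr\big[c\,n\le \mathrm{bw}(G)\le C\,n\big]=1,$$ where $\mathrm{bw}(G)$ denotes the branchwidth of $G$.
   Context: $G(n,\frac12)$ is the random simple graph on $n$ labelled vertices in which each of the $\binom n2$ possible edges appears independently with probability $\frac12$. Branchwidth is the standard notion of Robertson and Seymour: a branch decomposition of $G=(V,E)$ is a tree $T$ in which every internal node has degree $3$, together with a bijection between the leaves of $T$ and $E$. Removing an edge $e$ of $T$ splits $E$ into two parts; the width of $e$ is the number of vertices of $G$ incident with at least one edge in each part. The width of the decomposition is the maximum width over the edges of $T$, and $\mathrm{bw}(G)$ is the minimum width over all branch decompositions of $G$ (and $0$ if $G$ has at most one edge). *)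

theory Defs
  imports "HOL-Probability.Probability" "HOL-Library.Ramsey"
begin

text \<open>A graph is a pair of a vertex set and a set of edges, each edge being a two-element
  set of vertices (\<^term>\<open>nsets V 2\<close> is the set of all two-element subsets of \<^term>\<open>V\<close>).\<close>

type_synonym 'a graph = "'a set \<times> 'a set set"

abbreviation verts :: "'a graph \<Rightarrow> 'a set" where "verts \<equiv> fst"
abbreviation edges :: "'a graph \<Rightarrow> 'a set set" where "edges \<equiv> snd"

definition simple_graph :: "'a graph \<Rightarrow> bool" where
  "simple_graph G \<longleftrightarrow> finite (verts G) \<and> edges G \<subseteq> nsets (verts G) 2"

definition adj :: "'a graph \<Rightarrow> 'a rel" where
  "adj G = {(u, v). {u, v} \<in> edges G}"

definition components :: "'a graph \<Rightarrow> 'a set set" where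
  "components G = verts G // (adj G)\<^sup>*"

definition connected_graph :: "'a graph \<Rightarrow> bool" where
  "connected_graph G \<longleftrightarrow>
     verts G \<noteq> {} \<and> (\<forall>u\<in>verts G. \<forall>v\<in>verts G. (u, v) \<in> (adj G)\<^sup>*)"

definition is_cycle :: "'a graph \<Rightarrow> 'a list \<Rightarrow> bool" where
  "is_cycle G p \<longleftrightarrow> length p \<ge> 3 \<and> distinct p \<and>
     (\<forall>i. Suc i < length p \<longrightarrow> {p ! i, p ! Suc i} \<in> edges G) \<and> {last p, hd p} \<in> edges G"

definition is_tree :: "'a graph \<Rightarrow> bool" where
  "is_tree T \<longleftrightarrow> simple_graph T \<and> connected_graph T \<and> (\<nexists>p. is_cycle T p)"

definition degree :: "'a graph \<Rightarrow> 'a \<Rightarrow> nat" where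
  "degree G v = card {e \<in> edges G. v \<in> e}"

definition leaves :: "'a graph \<Rightarrow> 'a set" where
  "leaves T = {x \<in> verts T. degree T x = 1}"

definition remove_edge :: "'a graph \<Rightarrow> 'a set \<Rightarrow> 'a graph" where
  "remove_edge G e = (verts G, edges G - {e})"

definition branch_decomposition :: "'a graph \<Rightarrow> 'b graph \<Rightarrow> ('b \<Rightarrow> 'a set) \<Rightarrow> bool" where
  "branch_decomposition G T \<tau> \<longleftrightarrow>
     is_tree T \<and> (\<forall>x \<in> verts T - leaves T. degree T x = 3) \<and> bij_betw \<tau> (leaves T) (edges G)"

text \<open>The two components of the tree without the edge \<^term>\<open>f\<close> induce the two parts of
  the edge set of \<^term>\<open>G\<close>.\<close>

definition edge_parts :: "'b graph \<Rightarrow> ('b \<Rightarrow> 'a set) \<Rightarrow> 'b set \<Rightarrow> 'a set set set" where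
  "edge_parts T \<tau> f = (\<lambda>K. \<tau> ` (K \<inter> leaves T)) ` components (remove_edge T f)"

definition edge_width :: "'a graph \<Rightarrow> 'b graph \<Rightarrow> ('b \<Rightarrow> 'a set) \<Rightarrow> 'b set \<Rightarrow> nat" where
  "edge_width G T \<tau> f = card {v \<in> verts G. \<forall>P \<in> edge_parts T \<tau> f. \<exists>e\<in>P. v \<in> e}"

definition decomposition_width :: "'a graph \<Rightarrow> 'b graph \<Rightarrow> ('b \<Rightarrow> 'a set) \<Rightarrow> nat" where
  "decomposition_width G T \<tau> = Max (edge_width G T \<tau> ` edges T)"

text \<open>Every finite tree is isomorphic to one whose nodes are natural numbers, so it suffices
  to minimise over the latter.\<close>

definition branchwidth :: "'a graph \<Rightarrow> nat" where
  "branchwidth G = (if card (edges G) \<le> 1 then 0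
     else LEAST k. \<exists>(T :: nat graph) \<tau>.
            branch_decomposition G T \<tau> \<and> k = decomposition_width G T \<tau>)"

text \<open>Each potential edge independently gets a coin with success probability \<^term>\<open>p\<close>, and
  the edges of the random graph are those whose coin shows success.\<close>

definition random_graph :: "nat \<Rightarrow> real \<Rightarrow> nat graph pmf" where
  "random_graph n p =
     map_pmf (\<lambda>coin. ({..<n}, {e \<in> nsets {..<n} 2. coin e}))
       (Pi_pmf (nsets {..<n} 2) False (\<lambda>_. bernoulli_pmf p))"

end

theory Submission
  imports Defs "HOL-Real_Asymp.Real_Asymp"
begin

text \<open>
  The upper bound is deterministic with \<open>C = 1\<close>: a width counts vertices of the graph. All that is
  needed is that a branch decomposition exists at all, since otherwise the \<open>LEAST\<close> in
  \<^const>\<open>branchwidth\<close> would be unspecified. Lemma \<open>cubic_tree_exists\<close> grows a suitable tree by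
  repeatedly hanging two new nodes on a leaf.

  The lower bound rests on one pseudorandomness property. A bipartite hole of order \<open>k\<close> is a pair
  of disjoint vertex sets of size \<open>k\<close> without any edge between them. There are at most \<open>4 ^ n\<close>
  candidate pairs, and each is a hole with probability \<open>2 ^ (- k\<^sup>2)\<close>. Hence for \<open>k\<close> linear in \<open>n\<close>,
  almost surely there is no hole (\<open>prob_has_hole\<close>, \<open>hole_bound_tendsto_0\<close>).

  Suppose that a graph without holes of order \<open>k\<close> has a branch decomposition of width less
  than \<open>k\<close>. Each edge of the tree splits the edges of the graph into parts \<open>A\<close> and \<open>B\<close> that share
  fewer than \<open>k\<close> vertices. No edge joins a vertex met by \<open>A\<close> only to a vertex not met by \<open>A\<close>, so one
  of these two vertex sets has fewer than \<open>k\<close> elements, and therefore \<open>A\<close> or \<open>B\<close> meets fewer than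
  \<open>2 * k\<close> vertices (\<open>small_part_of_thin_separation\<close>). Call such a part small. Walking along the tree
  away from small parts ends in a node all of whose branches carry small parts
  (\<open>decomposition_width_ge\<close>). This node has at most three branches, so the edges of the graph meet
  at most \<open>6 * k + 2\<close> vertices altogether. All other vertices are isolated, and \<open>2 * k\<close> isolated
  vertices would contain a hole (\<open>card_covered\<close>). So the graph has fewer than \<open>8 * k + 2\<close> vertices.
  Taking \<open>k = n div 9\<close>, this is false for large \<open>n\<close>, and \<open>k\<close> is at least \<open>n / 10\<close>.
\<close>

section \<open>Sides of an edge of a tree\<close>

lemma sym_adj: "sym (adj G)"
  by (auto simp: adj_def sym_def insert_commute)

lemma equiv_reachable: "equiv UNIV ((adj G)\<^sup>*)"
  by (intro equivI refl_rtrancl sym_rtrancl sym_adj trans_rtrancl) simp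

text \<open>Needed because \<^const>\<open>is_cycle\<close> speaks about lists without repetition, whereas connectedness is
  expressed by a reflexive transitive closure. A path that returns to its first vertex is cut
  there.\<close>

lemma simple_path_of_rtrancl:
  assumes "(a, b) \<in> r\<^sup>*"
  shows "\<exists>p. p \<noteq> [] \<and> hd p = a \<and> last p = b \<and> distinct p \<and> successively (\<lambda>u v. (u, v) \<in> r) p"
  using assms
proof (induction rule: converse_rtrancl_induct)
  case base
  show ?case by (intro exI[of _ "[b]"]) auto
next
  case (step a a')
  then obtain p where p: "p \<noteq> []" "hd p = a'" "last p = b" "distinct p"
    "successively (\<lambda>u v. (u, v) \<in> r) p" by blast
  show ?case
  proof (cases "a \<in> set p")
    case True
    then obtain us vs where "p = us @ a # vs" by (meson split_list)
    with p show ?thesis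
      by (intro exI[of _ "a # vs"]) (auto simp: successively_append_iff)
  next
    case False
    with p step show ?thesis
      by (intro exI[of _ "a # p"]) (auto simp: successively_Cons)
  qed
qed

text \<open>For an edge between \<open>x\<close> and \<open>y\<close> this is the component that contains \<open>x\<close> once the edge is removed.
  Naming both ends gives the edge an orientation, which the search for a central node below
  relies on.\<close>

definition side :: "'b graph \<Rightarrow> 'b \<Rightarrow> 'b \<Rightarrow> 'b set" where
  "side T x y = (adj (remove_edge T {x, y}))\<^sup>* `` {x}"

lemma self_in_side [simp]: "x \<in> side T x y"
  by (simp add: side_def)

lemma side_step:
  assumes "u \<in> side T x y" "{u, v} \<in> edges T" "{u, v} \<noteq> {x, y}"
  shows "v \<in> side T x y"
proof -
  have "(u, v) \<in> adj (remove_edge T {x, y})"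
    using assms by (simp add: adj_def remove_edge_def)
  then show ?thesis using assms(1) unfolding side_def by (auto intro: rtrancl_into_rtrancl)
qed

lemma side_induct [consumes 1, case_names base step]:
  assumes "v \<in> side T x y" and "P x"
    and "\<And>u v. u \<in> side T x y \<Longrightarrow> P u \<Longrightarrow> {u, v} \<in> edges T \<Longrightarrow> {u, v} \<noteq> {x, y} \<Longrightarrow> P v"
  shows "P v"
proof -
  have "(x, v) \<in> (adj (remove_edge T {x, y}))\<^sup>*" using assms(1) by (simp add: side_def)
  then show ?thesis
  proof (induction rule: rtrancl_induct)
    case base
    show ?case by fact
  next
    case (step u v)
    then show ?case using assms(3)[of u v]
      by (simp add: side_def adj_def remove_edge_def)
  qed
qed

text \<open>Otherwise a path that avoids the edge would close up with it to a cycle. The path has at least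
  three vertices because it is not the edge itself.\<close>

lemma tree_edge_is_bridge:
  assumes "is_tree T" "{x, z} \<in> edges T"
  shows "x \<notin> side T z x"
proof
  assume "x \<in> side T z x"
  then have "(z, x) \<in> (adj (remove_edge T {z, x}))\<^sup>*" by (simp add: side_def)
  then obtain p where p: "p \<noteq> []" "hd p = z" "last p = x" "distinct p"
    and s: "successively (\<lambda>u v. (u, v) \<in> adj (remove_edge T {z, x})) p"
    using simple_path_of_rtrancl by metis
  have s': "{p ! i, p ! Suc i} \<in> edges T - {{z, x}}" if "Suc i < length p" for i
    using s that unfolding successively_conv_nth by (auto simp: adj_def remove_edge_def)
  have "x \<noteq> z" using assms by (auto simp: is_tree_def simple_graph_def nsets_def)
  have "length p \<noteq> 0" "length p \<noteq> 1" "length p \<noteq> 2"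
    using p \<open>x \<noteq> z\<close> s'[of 0] by (auto simp: length_Suc_conv numeral_2_eq_2)
  then have "length p \<ge> 3" by linarith
  then have "is_cycle T p"
    using p s' assms(2) by (auto simp: is_cycle_def)
  with assms(1) show False by (auto simp: is_tree_def)
qed

lemma tree_verts_finite: "is_tree T \<Longrightarrow> finite (verts T)"
  by (simp add: is_tree_def simple_graph_def)

lemma tree_edges_finite: "is_tree T \<Longrightarrow> finite (edges T)"
  unfolding is_tree_def simple_graph_def by (meson finite_imp_finite_nsets finite_subset)

lemma tree_edgeD:
  assumes "is_tree T" "{x, y} \<in> edges T"
  shows "x \<in> verts T" "y \<in> verts T" "x \<noteq> y"
  using assms by (auto simp: is_tree_def simple_graph_def nsets_def)

lemma tree_edgeE:
  assumes "is_tree T" "f \<in> edges T"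
  obtains x y where "f = {x, y}" "x \<noteq> y"
  using assms unfolding is_tree_def simple_graph_def nsets_def
  by (auto simp: card_2_iff)

lemma side_subset_verts:
  assumes "is_tree T" "x \<in> verts T"
  shows "side T x y \<subseteq> verts T"
proof
  fix v assume "v \<in> side T x y"
  then show "v \<in> verts T"
    by (induction rule: side_induct) (use assms tree_edgeD(2)[OF assms(1)] in \<open>simp_all\<close>)
qed

text \<open>Strict descent: passing through \<open>x\<close> to another neighbour \<open>z\<close> shrinks the side, because the side of
  \<open>z\<close> cannot come back to \<open>x\<close>. This is what makes a walk through the tree terminate.\<close>

lemma side_subset_side:
  assumes T: "is_tree T" and e: "{x, z} \<in> edges T" "{x, y} \<in> edges T" and "z \<noteq> y"
  shows "side T z x \<subset> side T x y"
proof
  have "z \<noteq> x" using tree_edgeD[OF T e(1)] by simp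
  show "side T z x \<subseteq> side T x y"
  proof
    fix v assume "v \<in> side T z x"
    then show "v \<in> side T x y"
    proof (induction rule: side_induct)
      case base
      show ?case using e(1) \<open>z \<noteq> y\<close> \<open>z \<noteq> x\<close>
        by (intro side_step[OF self_in_side]) (auto simp: doubleton_eq_iff)
    next
      case (step u v)
      have "v \<in> side T z x" using step side_step by metis
      then have "u \<noteq> x" "v \<noteq> x" using step tree_edge_is_bridge[OF T e(1)] by auto
      then show ?case using step by (intro side_step[OF step.IH]) (auto simp: doubleton_eq_iff)
    qed
  qed
  show "side T z x \<noteq> side T x y" using tree_edge_is_bridge[OF T e(1)] self_in_side by metis
qed

lemma connected_induct:
  assumes "is_tree T" "x \<in> verts T" "v \<in> verts T" "P x"
    and "\<And>u v. P u \<Longrightarrow> {u, v} \<in> edges T \<Longrightarrow> P v"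
  shows "P v"
proof -
  have "(x, v) \<in> (adj T)\<^sup>*" using assms by (simp add: is_tree_def connected_graph_def)
  then show ?thesis
    by (induction rule: rtrancl_induct) (use assms in \<open>auto simp: adj_def\<close>)
qed

lemma verts_eq_two_sides:
  assumes "is_tree T" "{x, y} \<in> edges T"
  shows "verts T = side T x y \<union> side T y x"
proof
  note xy = tree_edgeD[OF assms]
  show "verts T \<subseteq> side T x y \<union> side T y x"
  proof
    fix v assume "v \<in> verts T"
    with assms(1) xy(1) show "v \<in> side T x y \<union> side T y x"
    proof (rule connected_induct)
      show "x \<in> side T x y \<union> side T y x" by simp
      fix u w assume "u \<in> side T x y \<union> side T y x" "{u, w} \<in> edges T"
      then show "w \<in> side T x y \<union> side T y x"
        using side_step[of u T x y w] side_step[of u T y x w] self_in_side[of x T y] self_in_side[of y T x]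
        by (metis Un_iff doubleton_eq_iff)
    qed
  qed
  show "side T x y \<union> side T y x \<subseteq> verts T"
    using side_subset_verts[OF assms(1)] xy by blast
qed

lemma verts_eq_branches:
  assumes "is_tree T" "x \<in> verts T"
  shows "verts T \<subseteq> insert x (\<Union>z\<in>{z. {x, z} \<in> edges T}. side T z x)"
proof
  fix v assume "v \<in> verts T"
  with assms show "v \<in> insert x (\<Union>z\<in>{z. {x, z} \<in> edges T}. side T z x)"
  proof (rule connected_induct)
    fix u w assume u: "u \<in> insert x (\<Union>z\<in>{z. {x, z} \<in> edges T}. side T z x)" and e: "{u, w} \<in> edges T"
    show "w \<in> insert x (\<Union>z\<in>{z. {x, z} \<in> edges T}. side T z x)"
    proof (cases "u = x")
      case True
      then show ?thesis using e by auto
    next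
      case False
      then obtain z where z: "{x, z} \<in> edges T" "u \<in> side T z x" using u by auto
      show ?thesis
      proof (cases "w = x")
        case False
        with \<open>u \<noteq> x\<close> have "{u, w} \<noteq> {z, x}" by (auto simp: doubleton_eq_iff)
        then have "w \<in> side T z x" using side_step z e by metis
        then show ?thesis using z by auto
      qed auto
    qed
  qed auto
qed

lemma components_remove_edge:
  assumes "is_tree T" "{x, y} \<in> edges T"
  shows "components (remove_edge T {x, y}) = {side T x y, side T y x}"
proof -
  let ?R = "(adj (remove_edge T {x, y}))\<^sup>*"
  have cls: "?R `` {v} = ?R `` {w}" if "v \<in> ?R `` {w}" for v w
    using equiv_class_eq[OF equiv_reachable] that by (metis Image_singleton_iff)
  have sides: "side T x y = ?R `` {x}" "side T y x = ?R `` {y}"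
    by (auto simp: side_def insert_commute)
  have "components (remove_edge T {x, y}) = (\<lambda>v. ?R `` {v}) ` verts T"
    by (auto simp: components_def quotient_def remove_edge_def)
  also have "\<dots> = {side T x y, side T y x}"
  proof
    show "(\<lambda>v. ?R `` {v}) ` verts T \<subseteq> {side T x y, side T y x}"
      using verts_eq_two_sides[OF assms] cls unfolding sides by blast
    show "{side T x y, side T y x} \<subseteq> (\<lambda>v. ?R `` {v}) ` verts T"
      unfolding sides using tree_edgeD[OF assms] by blast
  qed
  finally show ?thesis .
qed

text \<open>Incident edges and neighbours are in bijection; the degree bounds the number of branches at a
  node.\<close>

lemma card_neighbours:
  assumes "is_tree T"
  shows "finite {z. {x, z} \<in> edges T}" "card {z. {x, z} \<in> edges T} = degree T x"
proof -
  have "{z. {x, z} \<in> edges T} \<subseteq> verts T" using tree_edgeD[OF assms] by blast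
  then show "finite {z. {x, z} \<in> edges T}" using tree_verts_finite[OF assms] finite_subset by blast
  have "bij_betw (\<lambda>z. {x, z}) {z. {x, z} \<in> edges T} {e \<in> edges T. x \<in> e}"
  proof (rule bij_betw_imageI)
    show "inj_on (\<lambda>z. {x, z}) {z. {x, z} \<in> edges T}" by (auto simp: inj_on_def doubleton_eq_iff)
    show "(\<lambda>z. {x, z}) ` {z. {x, z} \<in> edges T} = {e \<in> edges T. x \<in> e}"
    proof (intro equalityI subsetI)
      fix e assume e: "e \<in> {e \<in> edges T. x \<in> e}"
      then obtain a b where "e = {a, b}" using tree_edgeE[OF assms] by blast
      with e show "e \<in> (\<lambda>z. {x, z}) ` {z. {x, z} \<in> edges T}"
        by (auto simp: insert_commute)
    qed auto
  qed
  then show "card {z. {x, z} \<in> edges T} = degree T x"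
    unfolding degree_def by (rule bij_betw_same_card)
qed

section \<open>Existence of branch decompositions\<close>

definition add_pendant :: "'b graph \<Rightarrow> 'b \<Rightarrow> 'b \<Rightarrow> 'b graph" where
  "add_pendant T x y = (insert y (verts T), insert {x, y} (edges T))"

text \<open>On a cycle every vertex has two different neighbours, its predecessor and its successor. A vertex
  with \<open>x\<close> as its only neighbour would have both equal to \<open>x\<close>.\<close>

lemma not_cycle_pendant:
  assumes "is_cycle G p" and nb: "\<And>u. {u, y} \<in> edges G \<Longrightarrow> u = x"
  shows "y \<notin> set p"
proof
  let ?l = "length p"
  assume "y \<in> set p"
  then obtain i where i: "i < ?l" "p ! i = y" by (auto simp: in_set_conv_nth)
  have l: "?l \<ge> 3" and d: "distinct p"
    and s: "\<And>i. Suc i < ?l \<Longrightarrow> {p ! i, p ! Suc i} \<in> edges G"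
    and c: "{p ! (?l - 1), p ! 0} \<in> edges G"
    using assms(1) last_conv_nth[of p] hd_conv_nth[of p] by (fastforce simp: is_cycle_def)+
  have c': "{p ! 0, p ! (?l - 1)} \<in> edges G" using c by (simp add: insert_commute)
  have "p ! (if i = 0 then ?l - 1 else i - 1) = x"
    using nb s[of "i - 1"] c i by (cases i) auto
  moreover have "p ! (if Suc i = ?l then 0 else Suc i) = x"
  proof (cases "Suc i = ?l")
    case True
    then have "?l - 1 = i" by simp
    with True show ?thesis using nb c' i by auto
  next
    case False
    then show ?thesis using nb s[of i] i by (auto simp: insert_commute)
  qed
  ultimately have "(if i = 0 then ?l - 1 else i - 1) = (if Suc i = ?l then 0 else Suc i)"
    using d l i by (subst nth_eq_iff_index_eq[of p, symmetric]) auto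
  with l i show False by (auto split: if_splits)
qed

lemma is_tree_add_pendant:
  assumes T: "is_tree T" and x: "x \<in> verts T" and y: "y \<notin> verts T"
  shows "is_tree (add_pendant T x y)"
proof -
  let ?T = "add_pendant T x y"
  have xy: "x \<noteq> y" using x y by auto
  have "simple_graph ?T"
    using T x y xy by (auto simp: is_tree_def simple_graph_def add_pendant_def nsets_def)
  moreover have "connected_graph ?T"
  proof -
    have "(adj T)\<^sup>* \<subseteq> (adj ?T)\<^sup>*" by (intro rtrancl_mono) (auto simp: adj_def add_pendant_def)
    then have from_x: "(x, v) \<in> (adj ?T)\<^sup>*" if "v \<in> verts T" for v
      using that T x by (auto simp: is_tree_def connected_graph_def)
    have "(x, y) \<in> (adj ?T)\<^sup>*" by (intro r_into_rtrancl) (auto simp: adj_def add_pendant_def)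
    then have "(x, v) \<in> (adj ?T)\<^sup>*" if "v \<in> verts ?T" for v
      using that from_x by (auto simp: add_pendant_def)
    then have "(u, v) \<in> (adj ?T)\<^sup>*" if "u \<in> verts ?T" "v \<in> verts ?T" for u v
      using that symD[OF sym_rtrancl[OF sym_adj]] by (metis rtrancl_trans)
    moreover have "verts ?T \<noteq> {}" by (simp add: add_pendant_def)
    ultimately show ?thesis unfolding connected_graph_def by blast
  qed
  moreover have "\<not> is_cycle ?T p" for p
  proof
    assume p: "is_cycle ?T p"
    have "u = x" if "{u, y} \<in> edges ?T" for u
      using that xy tree_edgeD(2)[OF T, of u y] y by (auto simp: add_pendant_def doubleton_eq_iff)
    then have "y \<notin> set p" using not_cycle_pendant[OF p] by blast
    then have "e \<in> edges T" if "e \<in> edges ?T" "e \<subseteq> set p" for e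
      using that by (auto simp: add_pendant_def)
    moreover have "p \<noteq> []" using p by (auto simp: is_cycle_def)
    ultimately have "is_cycle T p" using p by (auto simp: is_cycle_def)
    then show False using T by (auto simp: is_tree_def)
  qed
  ultimately show ?thesis by (auto simp: is_tree_def)
qed

lemma degree_add_pendant:
  assumes T: "is_tree T" and x: "x \<in> verts T" and y: "y \<notin> verts T"
  shows "degree (add_pendant T x y) v = degree T v + (if v = x \<or> v = y then 1 else 0)"
proof -
  have "{x, y} \<notin> edges T" using tree_edgeD[OF T] y by blast
  moreover have "{e \<in> edges (add_pendant T x y). v \<in> e} =
      (if v = x \<or> v = y then insert {x, y} else id) {e \<in> edges T. v \<in> e}"
    by (auto simp: add_pendant_def)
  ultimately show ?thesis using tree_edges_finite[OF T] by (simp add: degree_def)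
qed

lemma degree_outside: "is_tree T \<Longrightarrow> y \<notin> verts T \<Longrightarrow> degree T y = 0"
  by (auto simp: degree_def is_tree_def simple_graph_def nsets_def card_eq_0_iff)

text \<open>Hanging two new nodes on a leaf turns the leaf into a node of degree 3 and raises the number of
  leaves by one. Starting from a single edge, this reaches every number of leaves from 2 on.\<close>

lemma cubic_tree_exists:
  assumes "m \<ge> 2"
  shows "\<exists>T :: nat graph. is_tree T \<and> (\<forall>x\<in>verts T. degree T x = 1 \<or> degree T x = 3) \<and> card (leaves T) = m"
  using assms
proof (induction m rule: dec_induct)
  case base
  let ?S = "({0}, {}) :: nat graph" let ?T = "add_pendant ?S 0 1"
  have T0: "is_tree ?S"
    by (auto simp: is_tree_def simple_graph_def connected_graph_def is_cycle_def)
  have deg: "degree ?T v = (if v = 0 \<or> v = 1 then 1 else 0)" for v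
  proof -
    have "degree ?S v = 0" by (simp add: degree_def)
    then show ?thesis using degree_add_pendant[OF T0, of 0 1 v] by simp
  qed
  have "leaves ?T = {0, 1}" unfolding leaves_def deg by (auto simp: add_pendant_def)
  then show ?case
    using is_tree_add_pendant[OF T0, of 0 1] deg by (intro exI[of _ ?T]) (auto simp: add_pendant_def)
next
  case (step m)
  then obtain T :: "nat graph" where T: "is_tree T" 
    and deg: "\<forall>x\<in>verts T. degree T x = 1 \<or> degree T x = 3" and m: "card (leaves T) = m" by blast
  have "leaves T \<noteq> {}" using m step by auto
  then obtain x where x: "x \<in> leaves T" by blast
  then have xT: "x \<in> verts T" "degree T x = 1" by (auto simp: leaves_def)
  obtain y where y: "y \<notin> verts T" using tree_verts_finite[OF T] infinite_UNIV_nat ex_new_if_finite by metis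
  let ?U = "add_pendant T x y"
  have U: "is_tree ?U" by (rule is_tree_add_pendant[OF T xT(1) y])
  obtain z where z: "z \<notin> verts ?U" using tree_verts_finite[OF U] infinite_UNIV_nat ex_new_if_finite by metis
  let ?W = "add_pendant ?U x z"
  have xU: "x \<in> verts ?U" using xT by (simp add: add_pendant_def)
  have W: "is_tree ?W" by (rule is_tree_add_pendant[OF U xU z])
  have ne: "y \<noteq> x" "z \<noteq> x" "z \<noteq> y" "z \<notin> verts T" using y z xT by (auto simp: add_pendant_def)
  have degW: "degree ?W v = (if v = x then 3 else if v = y \<or> v = z then 1 else degree T v)" for v
    using degree_add_pendant[OF T xT(1) y, of v] degree_add_pendant[OF U xU z, of v] xT ne y
      degree_outside[OF T] by auto
  have vW: "verts ?W = insert z (insert y (verts T))" by (simp add: add_pendant_def)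
  \<comment> \<open>\<open>x\<close> stops being a leaf, while \<open>y\<close> and \<open>z\<close> become leaves.\<close>
  have "leaves ?W = insert y (insert z (leaves T - {x}))"
    unfolding leaves_def degW vW using ne by auto
  moreover have "y \<notin> leaves T" "z \<notin> leaves T" using y ne by (auto simp: leaves_def)
  moreover have "finite (leaves T)" using tree_verts_finite[OF T] by (simp add: leaves_def)
  ultimately have "card (leaves ?W) = Suc m" using x m ne
    by (simp add: card_Diff_singleton) (metis Suc_pred card_gt_0_iff empty_iff)
  moreover have "\<forall>v\<in>verts ?W. degree ?W v = 1 \<or> degree ?W v = 3"
    unfolding degW vW using deg by auto
  ultimately show ?case using W by blast
qed

lemma branch_decomposition_exists:
  assumes "card (edges G) \<ge> 2"
  shows "\<exists>(T :: nat graph) \<tau>. branch_decomposition G T \<tau>"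
proof -
  obtain T :: "nat graph" where T: "is_tree T" "\<forall>x\<in>verts T. degree T x = 1 \<or> degree T x = 3"
    "card (leaves T) = card (edges G)"
    using cubic_tree_exists[OF assms] by blast
  have "finite (leaves T)" using tree_verts_finite[OF T(1)] by (simp add: leaves_def)
  moreover have "finite (edges G)" using assms by (intro card_ge_0_finite) simp
  ultimately obtain \<tau> where "bij_betw \<tau> (leaves T) (edges G)"
    using T(3) finite_same_card_bij by blast
  then have "branch_decomposition G T \<tau>"
    using T by (auto simp: branch_decomposition_def leaves_def)
  then show ?thesis by blast
qed

section \<open>Bipartite holes and branchwidth\<close>

definition bipartite_hole :: "'a graph \<Rightarrow> 'a set \<Rightarrow> 'a set \<Rightarrow> bool" where
  "bipartite_hole G X Y \<longleftrightarrow> X \<subseteq> verts G \<and> Y \<subseteq> verts G \<and> X \<inter> Y = {} \<and>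
     (\<forall>x\<in>X. \<forall>y\<in>Y. {x, y} \<notin> edges G)"

definition has_hole :: "nat \<Rightarrow> 'a graph \<Rightarrow> bool" where
  "has_hole k G \<longleftrightarrow> (\<exists>X Y. bipartite_hole G X Y \<and> card X = k \<and> card Y = k)"

text \<open>A hole may be shrunk on both sides, so forbidding the exact size \<open>k\<close> forbids all larger sizes.
  Fixing the size keeps the union bound over candidate pairs simple.\<close>

lemma hole_small_side:
  assumes "\<not> has_hole k G" "bipartite_hole G X Y"
  shows "card X < k \<or> card Y < k"
proof (rule ccontr)
  assume "\<not> ?thesis"
  then obtain X' Y' where "X' \<subseteq> X" "card X' = k" "Y' \<subseteq> Y" "card Y' = k"
    by (meson not_less obtain_subset_with_card_n)
  with assms(2) have "bipartite_hole G X' Y'" unfolding bipartite_hole_def by blast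
  with assms(1) \<open>card X' = k\<close> \<open>card Y' = k\<close> show False by (auto simp: has_hole_def)
qed

lemma Union_edges_subset: "simple_graph G \<Longrightarrow> \<Union> (edges G) \<subseteq> verts G"
  by (auto simp: simple_graph_def nsets_def)

lemma card_edge: "simple_graph G \<Longrightarrow> e \<in> edges G \<Longrightarrow> card e = 2"
  by (auto simp: simple_graph_def nsets_def)

text \<open>The vertices outside all edges are pairwise non-adjacent, so \<open>2 * k\<close> of them could be halved into a
  hole.\<close>

lemma card_covered:
  assumes G: "simple_graph G" and nh: "\<not> has_hole k G"
  shows "card (verts G) < card (\<Union> (edges G)) + 2 * k"
proof (rule ccontr)
  assume few: "\<not> ?thesis"
  let ?U = "verts G - \<Union> (edges G)"
  have fin: "finite (verts G)" using G by (simp add: simple_graph_def)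
  then have "card ?U = card (verts G) - card (\<Union> (edges G))"
    using Union_edges_subset[OF G] by (meson card_Diff_subset finite_subset)
  with few have U: "card ?U \<ge> 2 * k" by simp
  then obtain X where X: "X \<subseteq> ?U" "card X = k"
    using obtain_subset_with_card_n[of k ?U] by auto
  have "card (?U - X) = card ?U - k"
    using X fin by (metis card_Diff_subset finite_Diff finite_subset)
  moreover have "bipartite_hole G X (?U - X)"
    using X(1) unfolding bipartite_hole_def by auto
  ultimately show False using hole_small_side[OF nh] X U by fastforce
qed

text \<open>The vertices met only by \<open>A\<close> and the vertices not met by \<open>A\<close> form a bipartite hole: an edge at a
  vertex met only by \<open>A\<close> lies in \<open>A\<close>, and so its other end is met by \<open>A\<close>. If the first side
  has fewer than \<open>k\<close> elements, then adding the fewer than \<open>k\<close> shared vertices gives all vertices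
  met by \<open>A\<close>. If the second side does, then it and the shared vertices together contain all
  vertices met by \<open>B\<close>.\<close>

lemma small_part_of_thin_separation:
  assumes G: "simple_graph G" and nh: "\<not> has_hole k G"
    and AB: "edges G = A \<union> B" and thin: "card (\<Union>A \<inter> \<Union>B) < k"
  shows "card (\<Union>A) < 2 * k \<or> card (\<Union>B) < 2 * k"
proof -
  have fin: "finite (verts G)" using G by (simp add: simple_graph_def)
  have sub: "\<Union>A \<subseteq> verts G" "\<Union>B \<subseteq> verts G" using Union_edges_subset[OF G] AB by auto
  have "bipartite_hole G (\<Union>A - \<Union>B) (verts G - \<Union>A)"
    using sub AB unfolding bipartite_hole_def by auto
  with nh consider "card (\<Union>A - \<Union>B) < k" | "card (verts G - \<Union>A) < k"
    using hole_small_side by blast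
  then show ?thesis
  proof cases
    case 1
    have "card (\<Union>A) \<le> card (\<Union>A - \<Union>B) + card (\<Union>A \<inter> \<Union>B)"
      using card_Un_le[of "\<Union>A - \<Union>B" "\<Union>A \<inter> \<Union>B"] by (simp add: Un_Diff_Int)
    with 1 thin show ?thesis by simp
  next
    case 2
    have "card (\<Union>B) \<le> card ((verts G - \<Union>A) \<union> (\<Union>A \<inter> \<Union>B))"
      using sub fin by (intro card_mono) (auto intro: finite_subset)
    also have "\<dots> \<le> card (verts G - \<Union>A) + card (\<Union>A \<inter> \<Union>B)" by (rule card_Un_le)
    finally show ?thesis using 2 thin by simp
  qed
qed

definition part :: "'b graph \<Rightarrow> ('b \<Rightarrow> 'a set) \<Rightarrow> 'b \<Rightarrow> 'b \<Rightarrow> 'a set set" where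
  "part T \<tau> x y = \<tau> ` (side T x y \<inter> leaves T)"

lemma edges_eq_parts:
  assumes "branch_decomposition G T \<tau>" "{x, y} \<in> edges T"
  shows "edges G = part T \<tau> x y \<union> part T \<tau> y x"
proof -
  have T: "is_tree T" and "edges G = \<tau> ` leaves T"
    using assms(1) by (auto simp: branch_decomposition_def bij_betw_def)
  moreover have "verts T \<inter> leaves T = leaves T" by (auto simp: leaves_def)
  ultimately show ?thesis
    by (simp add: part_def verts_eq_two_sides[OF T assms(2)] flip: image_Un Int_Un_distrib2)
qed

lemma edge_width_eq:
  assumes G: "simple_graph G" and bd: "branch_decomposition G T \<tau>" and e: "{x, y} \<in> edges T"
  shows "edge_width G T \<tau> {x, y} = card (\<Union> (part T \<tau> x y) \<inter> \<Union> (part T \<tau> y x))"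
proof -
  have "is_tree T" using bd by (simp add: branch_decomposition_def)
  then have "edge_parts T \<tau> {x, y} = {part T \<tau> x y, part T \<tau> y x}"
    using e by (simp add: edge_parts_def components_remove_edge part_def)
  then have "{v \<in> verts G. \<forall>P\<in>edge_parts T \<tau> {x, y}. \<exists>e\<in>P. v \<in> e} =
      \<Union> (part T \<tau> x y) \<inter> \<Union> (part T \<tau> y x)"
    using Union_edges_subset[OF G] edges_eq_parts[OF bd e] by auto
  then show ?thesis by (simp add: edge_width_def)
qed

text \<open>The core of the lower bound. If all tree edges were thin, each would have a small part on one of
  its sides, and some node would have small parts in all its branches. The edges of the graph
  could then meet only few vertices.\<close>

lemma decomposition_width_ge:
  assumes G: "simple_graph G" and nh: "\<not> has_hole k G"
    and n: "8 * k + 2 \<le> card (verts G)" and bd: "branch_decomposition G T \<tau>"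
  shows "k \<le> decomposition_width G T \<tau>"
proof (rule ccontr)
  assume narrow: "\<not> ?thesis"
  have T: "is_tree T" and surj: "edges G = \<tau> ` leaves T"
    using bd by (auto simp: branch_decomposition_def bij_betw_def)
  let ?small = "\<lambda>x y. card (\<Union> (part T \<tau> x y)) < 2 * k"
  have small: "?small x y \<or> ?small y x" if e: "{x, y} \<in> edges T" for x y
  proof -
    have "edge_width G T \<tau> {x, y} \<le> decomposition_width G T \<tau>"
      unfolding decomposition_width_def using e tree_edges_finite[OF T] by (intro Max_ge) auto
    then have "card (\<Union> (part T \<tau> x y) \<inter> \<Union> (part T \<tau> y x)) < k"
      using narrow edge_width_eq[OF G bd e] by simp
    then show ?thesis
      using small_part_of_thin_separation[OF G nh edges_eq_parts[OF bd e]] by simp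
  qed
  obtain x where x: "x \<in> verts T" and around: "\<And>z. {x, z} \<in> edges T \<Longrightarrow> ?small z x"
  proof (cases "\<exists>x y. {x, y} \<in> edges T \<and> \<not> ?small x y")
    case False
    moreover obtain x where "x \<in> verts T"
      using T by (auto simp: is_tree_def connected_graph_def)
    ultimately show ?thesis using that by (metis insert_commute)
  next
    case True
    let ?P = "\<lambda>q. {fst q, snd q} \<in> edges T \<and> \<not> ?small (fst q) (snd q)"
    \<comment> \<open>An oriented edge with a large part on its near side, that side being as small as possible.
      Its near end is the central node.\<close>
    from True obtain p where "?P p" by auto
    then obtain q where "?P q" and least: "\<And>q'. ?P q' \<Longrightarrow>
        card (side T (fst q) (snd q)) \<le> card (side T (fst q') (snd q'))"
      using ex_has_least_nat[of ?P p "\<lambda>q. card (side T (fst q) (snd q))"] by blast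
    then obtain x y where xy: "{x, y} \<in> edges T" "\<not> ?small x y" and q: "q = (x, y)"
      by (cases q) auto
    have "?small z x" if z: "{x, z} \<in> edges T" for z
    proof (cases "z = y")
      case True
      then show ?thesis using small xy by blast
    next
      case False
      have "finite (side T x y)"
        using side_subset_verts[OF T] tree_edgeD[OF T xy(1)] tree_verts_finite[OF T]
        by (meson finite_subset)
      then have "card (side T z x) < card (side T x y)"
        using side_subset_side[OF T z xy(1) False] by (rule psubset_card_mono)
      then show ?thesis using least[of "(z, x)"] z q by (auto simp: insert_commute)
    qed
    then show ?thesis using that tree_edgeD[OF T xy(1)] by blast
  qed
  let ?N = "{z. {x, z} \<in> edges T}"
  \<comment> \<open>If the central node is itself a leaf, the edge of \<open>G\<close> that it carries lies in no branch.\<close>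
  let ?L = "if x \<in> leaves T then \<tau> x else {}"
  have fin: "finite (\<Union> (edges G))"
    using Union_edges_subset[OF G] G by (auto simp: simple_graph_def intro: finite_subset)
  have "leaves T \<subseteq> insert x (\<Union>z\<in>?N. side T z x)"
    using verts_eq_branches[OF T x] by (auto simp: leaves_def)
  then have cover: "\<Union> (edges G) \<subseteq> ?L \<union> (\<Union>z\<in>?N. \<Union> (part T \<tau> z x))"
    unfolding surj part_def by (fastforce split: if_splits)
  have sub: "\<Union> (part T \<tau> z x) \<subseteq> \<Union> (edges G)" for z
    unfolding surj part_def by auto
  have L: "finite ?L" "card ?L \<le> 2"
    using card_edge[OF G, of "\<tau> x"] surj by (auto intro: card_ge_0_finite)
  have "degree T x = 1 \<or> degree T x = 3"
    using bd x unfolding branch_decomposition_def leaves_def by blast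
  then have "card ?N \<le> 3" using card_neighbours(2)[OF T, of x] by linarith
  have N: "finite ?N" by (rule card_neighbours(1)[OF T])
  have "card (\<Union> (edges G)) \<le> card (?L \<union> (\<Union>z\<in>?N. \<Union> (part T \<tau> z x)))"
    using cover L N finite_subset[OF sub fin] by (intro card_mono) auto
  also have "\<dots> \<le> card ?L + card (\<Union>z\<in>?N. \<Union> (part T \<tau> z x))" by (rule card_Un_le)
  also have "card (\<Union>z\<in>?N. \<Union> (part T \<tau> z x)) \<le> (\<Sum>z\<in>?N. card (\<Union> (part T \<tau> z x)))"
    using N by (rule card_UN_le)
  also have "\<dots> \<le> (\<Sum>z\<in>?N. 2 * k)" using around by (intro sum_mono) (auto intro: less_imp_le)
  also have "\<dots> \<le> 3 * (2 * k)" using \<open>card ?N \<le> 3\<close> by simp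
  finally have "card (\<Union> (edges G)) \<le> 6 * k + 2" using L(2) by simp
  with card_covered[OF G nh] n show False by simp
qed

text \<open>The existence of an edge of the graph ensures that the tree has an edge, so that the maximum in
  \<^const>\<open>decomposition_width\<close> is over a nonempty set.\<close>

lemma decomposition_width_le:
  assumes G: "simple_graph G" and bd: "branch_decomposition G T \<tau>" and E: "edges G \<noteq> {}"
  shows "decomposition_width G T \<tau> \<le> card (verts G)"
proof -
  have T: "is_tree T" and "leaves T \<noteq> {}"
    using bd E by (auto simp: branch_decomposition_def bij_betw_def)
  then have "edges T \<noteq> {}" by (auto simp: leaves_def degree_def)
  moreover have "edge_width G T \<tau> f \<le> card (verts G)" for f
    unfolding edge_width_def using G by (intro card_mono) (auto simp: simple_graph_def)
  ultimately show ?thesis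
    unfolding decomposition_width_def using tree_edges_finite[OF T] by (subst Max_le_iff) auto
qed

lemma branchwidth_bounds:
  assumes G: "simple_graph G" and nh: "\<not> has_hole k G" and n: "8 * k + 2 \<le> card (verts G)"
  shows "k \<le> branchwidth G" "branchwidth G \<le> card (verts G)"
proof -
  have "card (\<Union> (edges G)) \<le> (\<Sum>e\<in>edges G. card e)" by (rule card_Union_le_sum_card)
  also have "\<dots> = 2 * card (edges G)" using card_edge[OF G] by simp
  finally have E: "card (edges G) \<ge> 2" using card_covered[OF G nh] n by linarith
  then have ne: "edges G \<noteq> {}" by auto
  let ?P = "\<lambda>k. \<exists>(T :: nat graph) \<tau>. branch_decomposition G T \<tau> \<and> k = decomposition_width G T \<tau>"
  have "branchwidth G = (LEAST k. ?P k)" using E by (simp add: branchwidth_def)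
  moreover have "\<exists>k. ?P k" using branch_decomposition_exists[OF E] by metis
  then have "?P (LEAST k. ?P k)" by (rule LeastI_ex)
  ultimately obtain T :: "nat graph" and \<tau> where "branch_decomposition G T \<tau>"
    "branchwidth G = decomposition_width G T \<tau>" by metis
  then show "k \<le> branchwidth G" "branchwidth G \<le> card (verts G)"
    using decomposition_width_ge[OF G nh n, of T \<tau>] decomposition_width_le[OF G, of T \<tau>] ne by simp_all
qed

section \<open>Random graphs\<close>

lemma random_graph_support:
  assumes "G \<in> set_pmf (random_graph n p)"
  shows "simple_graph G" "verts G = {..<n}"
  using assms by (auto simp: random_graph_def simple_graph_def)

lemma prob_all_tails:
  assumes "finite A" "F \<subseteq> A"
  shows "measure_pmf.prob (Pi_pmf A False (\<lambda>_. bernoulli_pmf (1/2))) {c. \<forall>e\<in>F. \<not> c e}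
    = (1/2) ^ card F"
proof -
  let ?B = "\<lambda>e. if e \<in> F then {False} else UNIV"
  have "{c. \<forall>e\<in>F. \<not> c e} = Pi A ?B" using assms(2) by (auto simp: Pi_def)
  then have "measure_pmf.prob (Pi_pmf A False (\<lambda>_. bernoulli_pmf (1/2))) {c. \<forall>e\<in>F. \<not> c e}
      = (\<Prod>e\<in>A. measure_pmf.prob (bernoulli_pmf (1/2)) (?B e))"
    using measure_Pi_pmf_Pi[OF assms(1)] by simp
  also have "\<dots> = (\<Prod>e\<in>A. if e \<in> F then 1/2 else 1)"
    by (intro prod.cong) (auto simp: measure_pmf_single)
  also have "\<dots> = (\<Prod>e\<in>A \<inter> F. 1/2)" using assms(1) by (rule prod.inter_restrict[symmetric])
  also have "A \<inter> F = F" using assms(2) by auto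
  finally show ?thesis by simp
qed

text \<open>Union bound: a hole is an ordered pair of subsets, hence the factor \<open>4 ^ n\<close>, and since its two
  sides are disjoint, it prescribes the outcome of exactly \<open>k\<^sup>2\<close> distinct coins.\<close>

lemma prob_has_hole:
  "measure_pmf.prob (random_graph n (1/2)) {G. has_hole k G} \<le> 4 ^ n / 2 ^ k\<^sup>2"
proof -
  let ?M = "Pi_pmf (nsets {..<n} 2) False (\<lambda>_. bernoulli_pmf (1/2))"
  let ?I = "{(X, Y). X \<subseteq> {..<n} \<and> Y \<subseteq> {..<n} \<and> X \<inter> Y = {} \<and> card X = k \<and> card Y = k}"
  let ?F = "\<lambda>(X, Y). (\<lambda>(x, y). {x, y}) ` (X \<times> Y)"
  let ?ev = "\<lambda>q. {c. \<forall>e\<in>?F q. \<not> c e}"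
  have sub: "?I \<subseteq> Pow {..<n} \<times> Pow {..<n}" by auto
  have fin: "finite ?I" using sub by (rule finite_subset) simp
  have "card ?I \<le> card (Pow {..<n} \<times> Pow {..<n})" using sub by (intro card_mono) auto
  also have "\<dots> = 4 ^ n" by (simp add: card_cartesian_product card_Pow power_mult_distrib[symmetric])
  finally have card_I: "real (card ?I) \<le> 4 ^ n"
    using of_nat_mono[of "card ?I" "4 ^ n", where 'a = real] by simp
  have F: "?F q \<subseteq> nsets {..<n} 2 \<and> card (?F q) = k\<^sup>2" if q_I: "q \<in> ?I" for q
  proof -
    obtain X Y where q: "q = (X, Y)" and XY: "X \<subseteq> {..<n}" "Y \<subseteq> {..<n}" "X \<inter> Y = {}" "card X = k" "card Y = k"
      using q_I by auto
    have "inj_on (\<lambda>(x, y). {x, y}) (X \<times> Y)"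
      using XY(3) by (auto simp: inj_on_def doubleton_eq_iff)
    then have "card (?F q) = k\<^sup>2"
      using XY by (simp add: q card_image card_cartesian_product power2_eq_square)
    moreover have "?F q \<subseteq> nsets {..<n} 2" using XY by (auto simp: q)
    ultimately show ?thesis by blast
  qed
  have "measure_pmf.prob (random_graph n (1/2)) {G. has_hole k G}
      \<le> measure_pmf.prob ?M (\<Union>q\<in>?I. ?ev q)"
    unfolding random_graph_def measure_map_pmf
  proof (rule measure_pmf.finite_measure_mono)
    show "(\<lambda>coin. ({..<n}, {e \<in> nsets {..<n} 2. coin e})) -` {G. has_hole k G} \<subseteq> (\<Union>q\<in>?I. ?ev q)"
    proof
      fix c assume "c \<in> (\<lambda>coin. ({..<n}, {e \<in> nsets {..<n} 2. coin e})) -` {G. has_hole k G}"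
      then obtain X Y where "bipartite_hole ({..<n}, {e \<in> nsets {..<n} 2. c e}) X Y"
        and k: "card X = k" "card Y = k" by (auto simp: has_hole_def)
      then have XY: "X \<subseteq> {..<n}" "Y \<subseteq> {..<n}" "X \<inter> Y = {}"
        and no_edge: "\<And>x y. x \<in> X \<Longrightarrow> y \<in> Y \<Longrightarrow> {x, y} \<in> nsets {..<n} 2 \<Longrightarrow> \<not> c {x, y}"
        by (auto simp: bipartite_hole_def)
      then have "(X, Y) \<in> ?I" using k by auto
      moreover have "\<not> c {x, y}" if "x \<in> X" "y \<in> Y" for x y
        using that XY by (intro no_edge) auto
      then have "c \<in> ?ev (X, Y)" by auto
      ultimately show "c \<in> (\<Union>q\<in>?I. ?ev q)" by blast
    qed
  qed simp
  also have "\<dots> \<le> (\<Sum>q\<in>?I. measure_pmf.prob ?M (?ev q))"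
    by (rule measure_pmf.finite_measure_subadditive_finite) (use fin in auto)
  also have "\<dots> = (\<Sum>q\<in>?I. (1/2) ^ k\<^sup>2)"
  proof (rule sum.cong)
    fix q assume "q \<in> ?I"
    then show "measure_pmf.prob ?M (?ev q) = (1/2) ^ k\<^sup>2"
      using F prob_all_tails[of "nsets {..<n} 2" "?F q"] by (simp add: finite_imp_finite_nsets)
  qed simp
  also have "\<dots> = real (card ?I) / 2 ^ k\<^sup>2" by (simp add: power_divide)
  also have "\<dots> \<le> 4 ^ n / 2 ^ k\<^sup>2" using card_I by (intro divide_right_mono) auto
  finally show ?thesis .
qed

lemma hole_bound_tendsto_0: "(\<lambda>n. 4 ^ n / 2 ^ (n div 9)\<^sup>2 :: real) \<longlonglongrightarrow> 0"
proof (rule tendsto_sandwich[where f = "\<lambda>_. 0"])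
  show "\<forall>\<^sub>F n in sequentially. (4 ^ n / 2 ^ (n div 9)\<^sup>2 :: real) \<le> 2 powr (2 * real n - (real n / 10)\<^sup>2)"
    using eventually_ge_at_top[of 90]
  proof eventually_elim
    case (elim n)
    have "real n / 10 \<le> real (n div 9)" using elim by linarith
    then have "(real n / 10)\<^sup>2 \<le> (real (n div 9))\<^sup>2" by (intro power_mono) auto
    moreover have "(4 ^ n / 2 ^ (n div 9)\<^sup>2 :: real) = 2 powr (2 * real n - (real (n div 9))\<^sup>2)"
    proof -
      have "(4::real) ^ n = 2 powr (2 * real n)"
        using powr_realpow[of 2 "2 * n"] by (simp add: power_mult)
      moreover have "(2::real) ^ (n div 9)\<^sup>2 = 2 powr ((real (n div 9))\<^sup>2)"
        using powr_realpow[of 2 "(n div 9)\<^sup>2"] by simp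
      ultimately show ?thesis by (simp add: powr_diff)
    qed
    ultimately show ?case by simp
  qed
  show "(\<lambda>n. 2 powr (2 * real n - (real n / 10)\<^sup>2)) \<longlonglongrightarrow> 0" by real_asymp
qed auto

theorem corollary3:
  shows "\<exists>c C :: real. 0 < c \<and> c \<le> C \<and>
    (\<lambda>n. measure_pmf.prob (random_graph n (1/2))
           {G. c * real n \<le> real (branchwidth G) \<and> real (branchwidth G) \<le> C * real n})
      \<longlonglongrightarrow> 1"
proof (intro exI conjI)
  let ?good = "\<lambda>n. {G :: nat graph. 1/10 * real n \<le> real (branchwidth G) \<and> real (branchwidth G) \<le> 1 * real n}"
  show "(\<lambda>n. measure_pmf.prob (random_graph n (1/2)) (?good n)) \<longlonglongrightarrow> 1"
  proof (rule tendsto_sandwich)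
    show "\<forall>\<^sub>F n in sequentially. 1 - 4 ^ n / 2 ^ (n div 9)\<^sup>2 \<le> measure_pmf.prob (random_graph n (1/2)) (?good n)"
      using eventually_ge_at_top[of 90]
    proof eventually_elim
      case (elim n)
      let ?k = "n div 9" and ?R = "random_graph n (1/2)"
      have k: "real n / 10 \<le> real ?k" "8 * ?k + 2 \<le> n" using elim by linarith+
      have "G \<in> ?good n" if "G \<in> set_pmf ?R" "\<not> has_hole ?k G" for G
        using branchwidth_bounds[of G ?k] random_graph_support[OF that(1)] that(2) k by auto
      then have "measure_pmf.prob ?R (UNIV - {G. has_hole ?k G}) \<le> measure_pmf.prob ?R (?good n)"
        by (intro measure_pmf.finite_measure_mono_AE AE_pmfI) auto
      then show ?case
        using prob_has_hole[of n ?k] measure_pmf.prob_compl[of "{G. has_hole ?k G}" ?R] by simp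
    qed
    show "(\<lambda>n. 1 - 4 ^ n / 2 ^ (n div 9)\<^sup>2 :: real) \<longlonglongrightarrow> 1"
      using tendsto_diff[OF tendsto_const hole_bound_tendsto_0] by simp
  qed auto
qed auto

end
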